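(* Let $n\ge1$ be an integer. For every regular point $x\in\mathbb{R}^n$, the cardinality of the set $\mathcal N(x)$ is $$|\mathcal N(x)|=(2n-1)!!=\frac{(2n)!}{2^n n!}.$$ In particular, this cardinality is the same for all regular points $x$.
   Context: For $x=(x_1,\dots,x_n)\in\mathbb{R}^n$ put $s_k(x)=x_1+\dots+x_k$, $1\le k\le n$, and let $C_{\mathrm{SA}}=\{x\in\mathbb{R}^n: s_1(x)\ge0,\dots,s_n(x)\ge0\}$. The group $\mathfrak B_n$ of signed permutations consists of pairs $g=(\sigma,\varepsilon)$ with $\sigma$ a permutation of $\{1,\dots,n\}$ and $\varepsilon\in\{\pm1\}^n$ (so it has $2^nn!$ elements), acting on $\mathbb{R}^n$ by $gx=(\varepsilon_1x_{\sigma(1)},\dots,\varepsilon_nx_{\sigma(n)})$. Define $\mathcal N(x)=\{g\in\mathfrak B_n: gx\in C_{\mathrm{SA}}\}$. A point $x\in\mathbb{R}^n$ is called regular if $s_m(gx)\ne0$ for all $g\in\mathfrak B_n$ and $m\in\{1,\dots,n\}$; equivalently, $\sum_{i\in I}\varepsilon_ix_i\ne0$ for every nonempty $I\subseteq\{1,\dots,n\}$ and all signs $\varepsilon_i\in\{\pm1\}$, $i\in I$. *)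

theory Defs
  imports Complex_Main "HOL-Library.FuncSet" "HOL-Combinatorics.Permutations"
begin

(* Points of R^n are extensional functions on {1..n}, so that n can be an ordinary natural
   number and the 1-based indexing agrees with the usual one. *)
definition Rn :: "nat \<Rightarrow> (nat \<Rightarrow> real) set" where
  "Rn n = {1..n} \<rightarrow>\<^sub>E UNIV"

definition partial_sum :: "nat \<Rightarrow> (nat \<Rightarrow> real) \<Rightarrow> real" where
  "partial_sum k x = (\<Sum>i=1..k. x i)"

definition C_SA :: "nat \<Rightarrow> (nat \<Rightarrow> real) set" where
  "C_SA n = {x \<in> Rn n. \<forall>k\<in>{1..n}. partial_sum k x \<ge> 0}"

(* Sign vectors are extensional and permutations are the identity outside {1..n}, so every
   signed permutation is represented by exactly one pair. *)
definition signed_perms :: "nat \<Rightarrow> ((nat \<Rightarrow> nat) \<times> (nat \<Rightarrow> real)) set" where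
  "signed_perms n = {\<sigma>. \<sigma> permutes {1..n}} \<times> ({1..n} \<rightarrow>\<^sub>E {1, -1})"

definition act :: "nat \<Rightarrow> (nat \<Rightarrow> nat) \<times> (nat \<Rightarrow> real) \<Rightarrow> (nat \<Rightarrow> real) \<Rightarrow> nat \<Rightarrow> real" where
  "act n g x = (\<lambda>i\<in>{1..n}. snd g i * x (fst g i))"

definition N_set :: "nat \<Rightarrow> (nat \<Rightarrow> real) \<Rightarrow> ((nat \<Rightarrow> nat) \<times> (nat \<Rightarrow> real)) set" where
  "N_set n x = {g \<in> signed_perms n. act n g x \<in> C_SA n}"

definition regular_point :: "nat \<Rightarrow> (nat \<Rightarrow> real) \<Rightarrow> bool" where
  "regular_point n x \<longleftrightarrow>
     x \<in> Rn n \<and> (\<forall>g\<in>signed_perms n. \<forall>m\<in>{1..n}. partial_sum m (act n g x) \<noteq> 0)"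

fun double_fact :: "nat \<Rightarrow> nat" where
  "double_fact 0 = 1"
| "double_fact (Suc 0) = 1"
| "double_fact (Suc (Suc n)) = Suc (Suc n) * double_fact n"

end

theory Submission
  imports Defs "HOL-Combinatorics.Multiset_Permutations"
begin

text \<open>
  By regularity the partial sums \<open>0 = s\<^sub>0, s\<^sub>1, \<dots>, s\<^sub>n\<close> of every signed rearrangement
  are pairwise distinct, so each of the \<open>2\<^sup>n n!\<close> signed rearrangements can be cut uniquely at the
  minimum. The part after the minimum has positive partial sums, and so does the part before it,
  once it is reversed and negated. Hence the numbers \<open>F T\<close> of arrangements of \<open>T \<subseteq> A\<close> with positive
  partial sums satisfy \<open>\<Sum>T\<subseteq>A. F T * F (A - T) = 2\<^sup>n n!\<close>, where \<open>A\<close> consists of the absolute values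
  of the coordinates. This determines \<open>F\<close> by induction, and \<open>(2 * card T - 1)!!\<close> solves the same
  recursion.
\<close>

section \<open>Signed arrangements, positive walks and reversal\<close>

text \<open>Lists of values replace pairs of a permutation and a sign vector, so that cutting and
  joining are list operations and the set of absolute values records which coordinates a piece
  uses.\<close>

definition signed_arrangements :: "real set \<Rightarrow> real list set" where
  "signed_arrangements A = {l. distinct (map abs l) \<and> abs ` set l = A}"

text \<open>The strict inequality is what makes the cut at the minimum unique; at a regular point it
  agrees with the weak one of \<open>C_SA\<close>.\<close>

definition positive_walk :: "real list \<Rightarrow> bool" where
  "positive_walk l \<longleftrightarrow> (\<forall>p q. l = p @ q \<longrightarrow> p \<noteq> [] \<longrightarrow> 0 < sum_list p)"

definition positive_arrangements :: "real set \<Rightarrow> real list set" where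
  "positive_arrangements A = {l \<in> signed_arrangements A. positive_walk l}"

text \<open>This is the same walk traversed from its end point back to its start.\<close>

definition reversal :: "real list \<Rightarrow> real list" where
  "reversal l = rev (map uminus l)"

text \<open>Regularity expressed through the set of absolute values alone, so that it passes to the
  subsets used in the induction.\<close>

definition generic :: "real set \<Rightarrow> bool" where
  "generic A \<longleftrightarrow>
     (\<forall>l. l \<noteq> [] \<longrightarrow> distinct (map abs l) \<longrightarrow> abs ` set l \<subseteq> A \<longrightarrow> sum_list l \<noteq> 0)"

lemma generic_subset: "generic A \<Longrightarrow> B \<subseteq> A \<Longrightarrow> generic B"
  unfolding generic_def by blast

lemma reversal_reversal [simp]: "reversal (reversal l) = l"
  by (simp add: reversal_def rev_map comp_def)

lemma reversal_append: "reversal (p @ q) = reversal q @ reversal p"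
  by (simp add: reversal_def)

lemma reversal_eq_Nil [simp]: "reversal l = [] \<longleftrightarrow> l = []"
  by (simp add: reversal_def)

lemma sum_list_reversal [simp]: "sum_list (reversal l) = - sum_list l"
  by (induction l) (auto simp: reversal_def)

lemma reversal_in_signed_arrangements [simp]:
  "reversal l \<in> signed_arrangements A \<longleftrightarrow> l \<in> signed_arrangements A"
  by (simp add: signed_arrangements_def reversal_def rev_map[symmetric] comp_def image_image)

text \<open>Prefixes of \<open>reversal l\<close> are reversed suffixes of \<open>l\<close>, with
  negated sums. The right-hand side says that the walk ends strictly below all its earlier
  positions.\<close>

lemma positive_walk_reversal_iff:
  "positive_walk (reversal l) \<longleftrightarrow> (\<forall>p q. l = p @ q \<longrightarrow> q \<noteq> [] \<longrightarrow> sum_list q < 0)"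
proof
  assume *: "positive_walk (reversal l)"
  show "\<forall>p q. l = p @ q \<longrightarrow> q \<noteq> [] \<longrightarrow> sum_list q < 0"
  proof (intro allI impI)
    fix p q assume "l = p @ q" "q \<noteq> []"
    then have "0 < sum_list (reversal q)"
      using * unfolding positive_walk_def by (metis reversal_append reversal_eq_Nil)
    then show "sum_list q < 0" by simp
  qed
next
  assume *: "\<forall>p q. l = p @ q \<longrightarrow> q \<noteq> [] \<longrightarrow> sum_list q < 0"
  show "positive_walk (reversal l)"
    unfolding positive_walk_def
  proof (intro allI impI)
    fix p q assume "reversal l = p @ q" "p \<noteq> []"
    then have "sum_list (reversal p) < 0"
      using * by (metis reversal_append reversal_eq_Nil reversal_reversal)
    then show "0 < sum_list p" by simp
  qed
qed

section \<open>Cutting a walk at its minimum\<close>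

text \<open>Prepending a step \<open>y\<close> to \<open>a @ b\<close> either keeps the minimum at
  the cut or moves it to the new start, according to the sign of the sum of \<open>y # a\<close>.
  Genericity rules out a tie.\<close>

lemma ex_split_at_minimum:
  assumes "distinct (map abs l)" and "generic (abs ` set l)"
  shows "\<exists>a b. l = a @ b \<and> positive_walk (reversal a) \<and> positive_walk b"
  using assms
proof (induction l)
  case Nil
  then show ?case by (simp add: positive_walk_def reversal_def)
next
  case (Cons y l)
  have "generic (abs ` set l)"
    using Cons.prems(2) by (rule generic_subset) auto
  then obtain a b where l: "l = a @ b"
    and neg: "\<And>p q. a = p @ q \<Longrightarrow> q \<noteq> [] \<Longrightarrow> sum_list q < 0"
    and pos: "\<And>p q. b = p @ q \<Longrightarrow> p \<noteq> [] \<Longrightarrow> 0 < sum_list p"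
    using Cons.IH Cons.prems(1) unfolding positive_walk_reversal_iff
    by (auto simp: positive_walk_def)
  have "distinct (map abs (y # a))" "abs ` set (y # a) \<subseteq> abs ` set (y # l)"
    using Cons.prems(1) l by auto
  then have nz: "sum_list (y # a) \<noteq> 0"
    using Cons.prems(2) unfolding generic_def by blast
  show ?case
  proof (cases "sum_list (y # a) < 0")
    case True
    have "positive_walk (reversal (y # a))"
      unfolding positive_walk_reversal_iff
      using True neg by (metis append_eq_Cons_conv)
    then show ?thesis
      using l pos by (metis append_Cons positive_walk_def)
  next
    case False
    then have ya: "0 < sum_list (y # a)" using nz by linarith
    \<comment> \<open>A prefix ending inside \<open>y # a\<close> has the positive sum of
      \<open>y # a\<close> minus that of a suffix of \<open>a\<close>, which is negative or empty. A
      longer prefix adds the sum of a prefix of \<open>b\<close>, which is positive.\<close>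
    have "positive_walk (y # l)"
      unfolding positive_walk_def
    proof (intro allI impI)
      fix p q assume "y # l = p @ q" "p \<noteq> []"
      then have "(y # a) @ b = p @ q" using l by simp
      then consider r where "y # a = p @ r" | r where "p = (y # a) @ r" "b = r @ q"
        unfolding append_eq_append_conv2 by blast
      then show "0 < sum_list p"
      proof cases
        case 1
        then obtain p' where p': "p = y # p'" "a = p' @ r"
          using \<open>p \<noteq> []\<close> by (auto simp: Cons_eq_append_conv)
        show ?thesis
          using neg[OF p'(2)] ya p' by (cases "r = []") auto
      next
        case 2
        then show ?thesis
          using pos[of r q] ya by (cases "r = []") auto
      qed
    qed
    then show ?thesis
      by (intro exI[of _ "[]"] exI[of _ "y # l"])
         (simp add: positive_walk_def reversal_def)
  qed
qed

text \<open>The piece \<open>c\<close> between two cuts would have negative sum as a suffix of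
  \<open>a'\<close> and positive sum as a prefix of \<open>b\<close>.\<close>

lemma split_at_minimum_prefix:
  assumes "positive_walk (reversal a')" "positive_walk b"
    and "a' = a @ c" "b = c @ b'"
  shows "c = []"
proof (rule ccontr)
  assume "c \<noteq> []"
  then have "sum_list c < 0" "0 < sum_list c"
    using assms unfolding positive_walk_reversal_iff unfolding positive_walk_def by blast+
  then show False by simp
qed

lemma split_at_minimum_unique:
  assumes "a @ b = a' @ b'"
    and "positive_walk (reversal a)" "positive_walk b"
    and "positive_walk (reversal a')" "positive_walk b'"
  shows "a = a' \<and> b = b'"
proof -
  from assms(1) consider c where "a = a' @ c" "b' = c @ b" | c where "a' = a @ c" "b = c @ b'"
    by (auto simp: append_eq_append_conv2)
  then show ?thesis
    using assms split_at_minimum_prefix by cases (metis append.right_neutral append_Nil)+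
qed

text \<open>Here \<open>T\<close> collects the absolute values that occur before the minimum. The
  left part is stored reversed, so both parts are positive arrangements, and counting both sides
  gives the recursion for their number.\<close>

lemma bij_betw_split_at_minimum:
  assumes "generic A"
  shows "bij_betw (\<lambda>(T, a, b). reversal a @ b)
           (SIGMA T:Pow A. positive_arrangements T \<times> positive_arrangements (A - T))
           (signed_arrangements A)"
  unfolding bij_betw_def
proof (intro conjI subset_antisym subsetI)
  show "inj_on (\<lambda>(T, a, b). reversal a @ b)
          (SIGMA T:Pow A. positive_arrangements T \<times> positive_arrangements (A - T))"
  proof (rule inj_onI, unfold split_paired_all prod.case mem_Sigma_iff prod.inject, elim conjE)
    fix T a b T' a' b'
    assume *: "a \<in> positive_arrangements T" "b \<in> positive_arrangements (A - T)"
      "a' \<in> positive_arrangements T'" "b' \<in> positive_arrangements (A - T')"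
      "reversal a @ b = reversal a' @ b'"
    then have "reversal a = reversal a' \<and> b = b'"
      by (intro split_at_minimum_unique) (simp_all add: positive_arrangements_def)
    then have "a = a'" "b = b'"
      by (metis reversal_reversal)+
    \<comment> \<open>The index \<open>T\<close> carries no extra information, being determined by
      \<open>a\<close>.\<close>
    moreover have "T = abs ` set a" "T' = abs ` set a'"
      using *(1,3) unfolding positive_arrangements_def signed_arrangements_def by blast+
    ultimately show "T = T' \<and> a = a' \<and> b = b'" by simp
  qed
next
  fix l
  assume "l \<in> (\<lambda>(T, a, b). reversal a @ b) `
    (SIGMA T:Pow A. positive_arrangements T \<times> positive_arrangements (A - T))"
  then obtain T a b where T: "T \<subseteq> A" and l: "l = reversal a @ b"
    and "a \<in> signed_arrangements T" and b: "b \<in> signed_arrangements (A - T)"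
    by (auto simp: positive_arrangements_def)
  then have "reversal a \<in> signed_arrangements T" by simp
  with b show "l \<in> signed_arrangements A"
    using T unfolding l signed_arrangements_def by (auto simp: image_Un)
next
  fix l assume l: "l \<in> signed_arrangements A"
  then obtain a b where ab: "l = a @ b" "positive_walk (reversal a)" "positive_walk b"
    using ex_split_at_minimum assms by (force simp: signed_arrangements_def)
  define T where "T = abs ` set a"
  have "T \<subseteq> A" "a \<in> signed_arrangements T" "b \<in> signed_arrangements (A - T)"
    using l by (auto simp: signed_arrangements_def ab(1) T_def)
  then have "(T, reversal a, b) \<in>
      (SIGMA T:Pow A. positive_arrangements T \<times> positive_arrangements (A - T))"
    using ab by (auto simp: positive_arrangements_def)
  then show "l \<in> (\<lambda>(T, a, b). reversal a @ b) `
      (SIGMA T:Pow A. positive_arrangements T \<times> positive_arrangements (A - T))"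
    by (rule rev_image_eqI) (simp add: ab)
qed

section \<open>Counting all signed arrangements\<close>

text \<open>As 0 is not in \<open>A\<close>, each entry is the product of its absolute value and a
  sign in {1, -1}, and both factors are determined by the entry.\<close>

lemma bij_betw_signed_arrangements:
  assumes "finite A" "A \<subseteq> {0<..}"
  shows "bij_betw (\<lambda>l. (map abs l, map sgn l)) (signed_arrangements A)
           (permutations_of_set A \<times> {s. set s \<subseteq> {1, -1} \<and> length s = card A})"
proof -
  have eqs: "map abs (map2 (*) p s) = p" "map sgn (map2 (*) p s) = s"
    if p: "p \<in> permutations_of_set A" and s: "set s \<subseteq> {1, -1}" "length s = card A" for p s
  proof -
    have len: "length p = length s"
      using length_finite_permutations_of_set[OF p] s by simp
    have *: "\<bar>p ! i * s ! i\<bar> = p ! i \<and> sgn (p ! i * s ! i) = s ! i" if "i < length s" for i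
    proof -
      have "0 < p ! i"
        using that len permutations_of_setD(1)[OF p] assms(2) by auto
      moreover have "s ! i \<in> {1, -1}"
        using s(1) nth_mem[OF that] by (rule subsetD)
      ultimately show ?thesis by auto
    qed
    show "map abs (map2 (*) p s) = p" "map sgn (map2 (*) p s) = s"
      using len * by (simp_all add: list_eq_iff_nth_eq)
  qed
  show ?thesis
  proof (rule bij_betw_byWitness[where f' = "\<lambda>(p, s). map2 (*) p s"])
    show "\<forall>l\<in>signed_arrangements A. (case (map abs l, map sgn l) of (p, s) \<Rightarrow> map2 (*) p s) = l"
      by (simp add: map2_map_map abs_mult_sgn)
    show "\<forall>ps\<in>permutations_of_set A \<times> {s. set s \<subseteq> {1, -1} \<and> length s = card A}.
        (\<lambda>l. (map abs l, map sgn l)) (case ps of (p, s) \<Rightarrow> map2 (*) p s) = ps"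
    proof clarify
      fix p s :: "real list"
      assume "p \<in> permutations_of_set A" "set s \<subseteq> {1, -1}" "length s = card A"
      from eqs[OF this] show "map abs (map2 (*) p s) = p \<and> map sgn (map2 (*) p s) = s" ..
    qed
    show "(\<lambda>l. (map abs l, map sgn l)) ` signed_arrangements A
        \<subseteq> permutations_of_set A \<times> {s. set s \<subseteq> {1, -1} \<and> length s = card A}"
    proof (rule image_subsetI)
      fix l assume "l \<in> signed_arrangements A"
      then have l: "distinct (map abs l)" "set (map abs l) = A"
        unfolding signed_arrangements_def set_map by blast+
      then have "length l = card A"
        by (metis distinct_card length_map)
      moreover have "sgn y \<in> {1, -1}" if "y \<in> set l" for y
      proof -
        have "0 < \<bar>y\<bar>" using that l(2) assms(2) by auto
        then show ?thesis by (simp add: sgn_if)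
      qed
      ultimately show "(map abs l, map sgn l) \<in>
          permutations_of_set A \<times> {s. set s \<subseteq> {1, -1} \<and> length s = card A}"
        using l by (simp add: permutations_of_setI image_subset_iff)
    qed
    show "(\<lambda>(p, s). map2 (*) p s) ` (permutations_of_set A \<times>
        {s. set s \<subseteq> {1, -1} \<and> length s = card A}) \<subseteq> signed_arrangements A"
    proof clarify
      fix p s :: "real list"
      assume p: "p \<in> permutations_of_set A" and s: "set s \<subseteq> {1, -1}" "length s = card A"
      have "map abs (map2 (*) p s) = p"
        using eqs(1)[OF p s] .
      moreover from this have "abs ` set (map2 (*) p s) = set p"
        by (metis list.set_map)
      ultimately show "map2 (*) p s \<in> signed_arrangements A"
        using p unfolding signed_arrangements_def permutations_of_set_def by simp
    qed
  qed
qed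

lemma
  assumes "finite A" "A \<subseteq> {0<..}"
  shows finite_signed_arrangements: "finite (signed_arrangements A)"
    and card_signed_arrangements: "card (signed_arrangements A) = 2 ^ card A * fact (card A)"
proof -
  have fin: "finite {s. set s \<subseteq> {1, -1 :: real} \<and> length s = card A}"
    by (rule finite_lists_length_eq) simp
  show "finite (signed_arrangements A)"
    using bij_betw_finite[OF bij_betw_signed_arrangements[OF assms]] fin by simp
  show "card (signed_arrangements A) = 2 ^ card A * fact (card A)"
    using bij_betw_same_card[OF bij_betw_signed_arrangements[OF assms]] assms(1)
    by (simp add: card_cartesian_product card_lists_length_eq numeral_2_eq_2)
qed

section \<open>Odd double factorials and their convolution over subsets\<close>

text \<open>Truncated subtraction gives \<open>double_fact (2 * 0 - 1) = 1\<close>, the value of \<open>(-1)!!\<close>.\<close>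

lemma double_fact_odd_Suc:
  "double_fact (2 * Suc k - 1) = (2 * k + 1) * double_fact (2 * k - 1)"
  by (cases k) auto

lemma double_fact_odd: "double_fact (2 * n - 1) * (2 ^ n * fact n) = fact (2 * n)"
proof (induction n)
  case (Suc n)
  have "double_fact (2 * Suc n - 1) * (2 ^ Suc n * fact (Suc n)) =
      (2 * n + 1) * (2 * n + 2) * (double_fact (2 * n - 1) * (2 ^ n * fact n))"
    unfolding double_fact_odd_Suc by (simp add: algebra_simps)
  then show ?case
    unfolding Suc.IH by (simp add: algebra_simps)
qed simp

text \<open>In exponential generating functions this says that (1 - 2z)^(-1/2) squares to (1 -
  2z)^(-1). The induction puts the new element either into \<open>T\<close> or into its
  complement.\<close>

lemma sum_Pow_double_fact_odd:
  assumes "finite A"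
  shows "(\<Sum>T\<in>Pow A. double_fact (2 * card T - 1) * double_fact (2 * card (A - T) - 1)) =
           2 ^ card A * fact (card A)"
  using assms
proof (induction A rule: finite_induct)
  case (insert a A)
  let ?d = "\<lambda>k. double_fact (2 * k - 1)"
  let ?f = "\<lambda>T. ?d (card T) * ?d (card (insert a A - T))"
  have inj: "inj_on (insert a) (Pow A)"
    using insert.hyps by (intro inj_onI) auto
  have "(\<Sum>T\<in>Pow (insert a A). ?f T) = (\<Sum>T\<in>Pow A. ?f T) + (\<Sum>T\<in>insert a ` Pow A. ?f T)"
    unfolding Pow_insert using insert.hyps by (intro sum.union_disjoint) auto
  also have "\<dots> = (\<Sum>T\<in>Pow A. ?f T + ?f (insert a T))"
    by (simp add: sum.reindex[OF inj] sum.distrib)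
  also have "\<dots> = (\<Sum>T\<in>Pow A. (2 * card A + 2) * (?d (card T) * ?d (card (A - T))))"
  proof (rule sum.cong[OF refl])
    fix T assume "T \<in> Pow A"
    then have T: "finite T" "T \<subseteq> A" "a \<notin> T"
      using insert.hyps finite_subset by auto
    have 1: "card (insert a A - T) = Suc (card (A - T))"
      using T insert.hyps by (simp add: insert_Diff_if)
    have 2: "insert a A - insert a T = A - T"
      using insert.hyps by auto
    have 3: "card A = card T + card (A - T)"
      using T insert.hyps by (metis card_Diff_subset card_mono le_add_diff_inverse)
    \<comment> \<open>With k = \<open>card T\<close> and m = \<open>card A\<close>, the two choices
      contribute the factors 2(m - k) + 1 and 2k + 1, whose sum 2m + 2 does not depend on
      \<open>T\<close>.\<close>
    show "?f T + ?f (insert a T) =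
        (2 * card A + 2) * (?d (card T) * ?d (card (A - T)))"
      unfolding 1 2 card_insert_disjoint[OF T(1,3)] double_fact_odd_Suc 3
      by (simp add: algebra_simps)
  qed
  also have "\<dots> = (2 * card A + 2) * (2 ^ card A * fact (card A))"
    unfolding sum_distrib_left[symmetric] insert.IH ..
  also have "\<dots> = 2 ^ card (insert a A) * fact (card (insert a A))"
    using insert.hyps by (simp add: algebra_simps)
  finally show ?case .
qed simp

section \<open>Counting positive arrangements\<close>

lemma positive_arrangements_empty: "positive_arrangements {} = {[]}"
  by (auto simp: positive_arrangements_def signed_arrangements_def positive_walk_def)

text \<open>Both sides satisfy the same convolution identity with value 1 at the empty set, and this
  identity determines the value at \<open>A\<close> from the values at proper subsets.\<close>

theorem card_positive_arrangements:
  assumes "finite A" "A \<subseteq> {0<..}" "generic A"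
  shows "card (positive_arrangements A) = double_fact (2 * card A - 1)"
  using assms
proof (induction A rule: finite_psubset_induct)
  case (psubset A)
  let ?F = "\<lambda>T. card (positive_arrangements T)"
  let ?d = "\<lambda>T :: real set. double_fact (2 * card T - 1)"
  show ?case
  proof (cases "A = {}")
    case True
    then show ?thesis by (simp add: positive_arrangements_empty)
  next
    case False
    have fin: "finite (positive_arrangements T)" if "T \<subseteq> A" for T
    proof -
      have "finite (signed_arrangements T)"
        using that psubset.hyps psubset.prems(1) finite_subset
        by (intro finite_signed_arrangements) auto
      then show ?thesis by (simp add: positive_arrangements_def)
    qed
    have IH: "?F T = ?d T" if "T \<subset> A" for T
      using that psubset.IH psubset.prems generic_subset by (meson order.trans psubset_imp_subset)
    have "(\<Sum>T\<in>Pow A. ?F T * ?F (A - T)) =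
        card (SIGMA T:Pow A. positive_arrangements T \<times> positive_arrangements (A - T))"
      using psubset.hyps fin by (subst card_SigmaI) (auto simp: card_cartesian_product)
    also have "\<dots> = (\<Sum>T\<in>Pow A. ?d T * ?d (A - T))"
      using bij_betw_same_card[OF bij_betw_split_at_minimum[OF psubset.prems(2)]]
        card_signed_arrangements[OF psubset.hyps psubset.prems(1)]
        sum_Pow_double_fact_odd[OF psubset.hyps] by simp
    finally have eq: "(\<Sum>T\<in>Pow A. ?F T * ?F (A - T)) = (\<Sum>T\<in>Pow A. ?d T * ?d (A - T))" .
    \<comment> \<open>For nonempty \<open>A\<close> the sets \<open>{}\<close> and \<open>A\<close>
      are two different indices, and they are the only ones whose summand involves the value at
      \<open>A\<close>.\<close>
    have split_off_ends: "(\<Sum>T\<in>Pow A. g T) = g {} + g A + (\<Sum>T\<in>Pow A - {{}, A}. g T)" for g :: "real set \<Rightarrow> nat"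
      using False psubset.hyps sum.subset_diff[of "{{}, A}" "Pow A" g] by simp
    have "(\<Sum>T\<in>Pow A - {{}, A}. ?F T * ?F (A - T)) = (\<Sum>T\<in>Pow A - {{}, A}. ?d T * ?d (A - T))"
    proof (rule sum.cong[OF refl])
      fix T assume "T \<in> Pow A - {{}, A}"
      then have "T \<subset> A" "A - T \<subset> A" by auto
      then show "?F T * ?F (A - T) = ?d T * ?d (A - T)"
        using IH by simp
    qed
    \<comment> \<open>After cancellation, twice the count at \<open>A\<close> equals twice the
      double factorial.\<close>
    then show ?thesis
      using eq unfolding split_off_ends by (simp add: positive_arrangements_empty)
  qed
qed

section \<open>From signed permutations to signed arrangements\<close>

definition arrangement :: "nat \<Rightarrow> (nat \<Rightarrow> real) \<Rightarrow> (nat \<Rightarrow> nat) \<times> (nat \<Rightarrow> real) \<Rightarrow> real list" where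
  "arrangement n x g = map (act n g x) [1..<Suc n]"

lemma length_arrangement [simp]: "length (arrangement n x g) = n"
  by (simp add: arrangement_def)

lemma sum_list_take_arrangement:
  assumes "m \<le> n"
  shows "sum_list (take m (arrangement n x g)) = partial_sum m (act n g x)"
proof -
  have "take m (arrangement n x g) = map (act n g x) [1..<Suc m]"
    using assms by (simp add: arrangement_def take_map del: upt_Suc)
  then show ?thesis
    by (simp only: interv_sum_list_conv_sum_set_nat set_upt partial_sum_def
        atLeastLessThanSuc_atLeastAtMost)
qed

text \<open>A transposition brings \<open>x i\<close> to the first place, where it is the first
  partial sum.\<close>

lemma regular_point_nonzero:
  assumes "regular_point n x" "i \<in> {1..n}"
  shows "x i \<noteq> 0"
proof -
  define g :: "(nat \<Rightarrow> nat) \<times> (nat \<Rightarrow> real)" where "g = (transpose 1 i, \<lambda>k\<in>{1..n}. 1)"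
  have "g \<in> signed_perms n"
    using assms(2) by (auto simp: g_def signed_perms_def intro!: permutes_swap_id)
  moreover have "1 \<in> {1..n}" using assms(2) by auto
  ultimately have "partial_sum 1 (act n g x) \<noteq> 0"
    using assms(1) unfolding regular_point_def by blast
  then show ?thesis
    using \<open>1 \<in> {1..n}\<close> by (simp add: partial_sum_def act_def g_def)
qed

text \<open>If two coordinates agree up to sign, placing them first and second with suitable signs
  makes the second partial sum vanish.\<close>

lemma regular_point_inj_on_abs:
  assumes "regular_point n x"
  shows "inj_on (\<lambda>i. \<bar>x i\<bar>) {1..n}"
proof (rule inj_onI, rule ccontr)
  fix i j assume i: "i \<in> {1..n}" and j: "j \<in> {1..n}" and eq: "\<bar>x i\<bar> = \<bar>x j\<bar>" and "i \<noteq> j"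
  then have n: "1 \<in> {1..n}" "2 \<in> {1..n}" by auto
  \<comment> \<open>The composed permutation in \<open>g\<close> must send 1 to \<open>i\<close> and
    2 to \<open>j\<close>. Since \<open>transpose 1 i\<close> is an involution, it maps
    \<open>k\<close> to \<open>j\<close>; and \<open>k\<close> differs from 1, so
    \<open>transpose 2 k\<close> fixes 1.\<close>
  define k where "k = transpose 1 i j"
  define s :: real where "s = (if x i = x j then -1 else 1)"
  define g :: "(nat \<Rightarrow> nat) \<times> (nat \<Rightarrow> real)"
    where "g = (transpose 1 i \<circ> transpose 2 k, \<lambda>m\<in>{1..n}. if m = 2 then s else 1)"
  have k: "k \<in> {1..n}" "k \<noteq> 1"
    using i j n \<open>i \<noteq> j\<close> by (auto simp: k_def transpose_def)
  have "g \<in> signed_perms n"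
    using i k n by (auto simp: g_def s_def signed_perms_def intro!: permutes_swap_id permutes_compose)
  then have "partial_sum 2 (act n g x) \<noteq> 0"
    using assms n(2) unfolding regular_point_def by blast
  moreover have "fst g 1 = i"
    using k(2) by (simp add: g_def transpose_apply_other)
  moreover have "fst g 2 = j"
    by (simp add: g_def k_def)
  moreover have "snd g 1 = 1" "snd g 2 = s"
    using n by (auto simp: g_def)
  moreover have "{1..2} = {1, 2::nat}" by auto
  ultimately have "x i + s * x j \<noteq> 0"
    using n by (simp add: partial_sum_def act_def)
  then show False
    using eq by (auto simp: s_def abs_eq_iff)
qed

text \<open>Distinct absolute values determine the permutation, and nonzero coordinates then
  determine the signs. Surjectivity follows by counting, both sets having 2^n n! elements.\<close>

lemma bij_betw_arrangement:
  assumes "regular_point n x"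
  shows "bij_betw (arrangement n x) (signed_perms n) (signed_arrangements ((\<lambda>i. \<bar>x i\<bar>) ` {1..n}))"
proof -
  let ?A = "(\<lambda>i. \<bar>x i\<bar>) ` {1..n}"
  note inj = regular_point_inj_on_abs[OF assms]
  have A: "finite ?A" "?A \<subseteq> {0<..}" "card ?A = n"
    using regular_point_nonzero[OF assms] card_image[OF inj] by auto
  have abs_act: "\<bar>act n (\<sigma>, \<epsilon>) x i\<bar> = \<bar>x (\<sigma> i)\<bar>"
    if "(\<sigma>, \<epsilon>) \<in> signed_perms n" "i \<in> {1..n}" for \<sigma> \<epsilon> i
  proof -
    have "\<epsilon> i = 1 \<or> \<epsilon> i = -1"
      using that by (auto simp: signed_perms_def dest!: PiE_mem)
    then show ?thesis using that(2) by (auto simp: act_def)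
  qed
  have inj_arr: "inj_on (arrangement n x) (signed_perms n)"
  proof (rule inj_onI, clarify)
    fix \<sigma> \<epsilon> \<sigma>' \<epsilon>'
    assume g: "(\<sigma>, \<epsilon>) \<in> signed_perms n" "(\<sigma>', \<epsilon>') \<in> signed_perms n"
      and "arrangement n x (\<sigma>, \<epsilon>) = arrangement n x (\<sigma>', \<epsilon>')"
    then have act: "act n (\<sigma>, \<epsilon>) x i = act n (\<sigma>', \<epsilon>') x i" if "i \<in> {1..n}" for i
      using that by (auto simp: arrangement_def simp del: upt_Suc)
    have perm: "\<sigma> permutes {1..n}" "\<sigma>' permutes {1..n}"
      using g by (auto simp: signed_perms_def)
    have \<sigma>: "\<sigma> i = \<sigma>' i" if "i \<in> {1..n}" for i
    proof (rule inj_onD[OF inj])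
      show "\<bar>x (\<sigma> i)\<bar> = \<bar>x (\<sigma>' i)\<bar>"
        using abs_act[OF g(1) that] abs_act[OF g(2) that] act[OF that] by simp
    qed (use perm that permutes_in_image in metis)+
    have "\<sigma> = \<sigma>'"
      using perm \<sigma> by (metis ext permutes_not_in)
    moreover have "\<epsilon> = \<epsilon>'"
    proof (rule PiE_ext)
      show "\<epsilon> \<in> {1..n} \<rightarrow>\<^sub>E {1, -1}" "\<epsilon>' \<in> {1..n} \<rightarrow>\<^sub>E {1, -1}"
        using g by (auto simp: signed_perms_def)
      fix i assume i: "i \<in> {1..n}"
      then have "\<sigma> i \<in> {1..n}" using perm(1) permutes_in_image by metis
      then have "x (\<sigma> i) \<noteq> 0" using regular_point_nonzero[OF assms] by blast
      then show "\<epsilon> i = \<epsilon>' i" using act[OF i] \<sigma>[OF i] i by (simp add: act_def)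
    qed
    ultimately show "\<sigma> = \<sigma>' \<and> \<epsilon> = \<epsilon>'" ..
  qed
  have "arrangement n x ` signed_perms n \<subseteq> signed_arrangements ?A"
  proof (rule image_subsetI, clarify)
    fix \<sigma> \<epsilon> assume g: "(\<sigma>, \<epsilon>) \<in> signed_perms n"
    then have perm: "\<sigma> permutes {1..n}" by (simp add: signed_perms_def)
    have eq: "map abs (arrangement n x (\<sigma>, \<epsilon>)) = map ((\<lambda>i. \<bar>x i\<bar>) \<circ> \<sigma>) [1..<Suc n]"
      using abs_act[OF g] by (auto simp: arrangement_def simp del: upt_Suc)
    have set: "set [1..<Suc n] = {1..n}"
      by (simp add: atLeastLessThanSuc_atLeastAtMost del: upt_Suc)
    have "inj_on ((\<lambda>i. \<bar>x i\<bar>) \<circ> \<sigma>) {1..n}"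
      using inj permutes_image[OF perm] permutes_inj_on[OF perm] by (intro comp_inj_on) auto
    then have "distinct (map abs (arrangement n x (\<sigma>, \<epsilon>)))"
      unfolding eq distinct_map set by simp
    moreover have "abs ` set (arrangement n x (\<sigma>, \<epsilon>)) = ?A"
      using arg_cong[OF eq, of set] permutes_image[OF perm]
      unfolding list.set_map set image_comp[symmetric] by simp
    ultimately show "arrangement n x (\<sigma>, \<epsilon>) \<in> signed_arrangements ?A"
      by (simp add: signed_arrangements_def)
  qed
  moreover have "card (signed_perms n) = card (signed_arrangements ?A)"
    unfolding card_signed_arrangements[OF A(1,2)] A(3) signed_perms_def
    by (simp add: card_cartesian_product card_permutations card_PiE numeral_2_eq_2)
  ultimately have "arrangement n x ` signed_perms n = signed_arrangements ?A"
    using finite_signed_arrangements[OF A(1,2)] card_image[OF inj_arr]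
    by (intro card_subset_eq) auto
  with inj_arr show ?thesis by (simp add: bij_betw_def)
qed

text \<open>Any list of signed coordinates extends to a full signed arrangement, so its sum is a
  partial sum of some signed rearrangement of \<open>x\<close>.\<close>

lemma regular_point_generic:
  assumes "regular_point n x"
  shows "generic ((\<lambda>i. \<bar>x i\<bar>) ` {1..n})"
  unfolding generic_def
proof (intro allI impI)
  let ?A = "(\<lambda>i. \<bar>x i\<bar>) ` {1..n}"
  fix l :: "real list"
  assume l: "l \<noteq> []" "distinct (map abs l)" "abs ` set l \<subseteq> ?A"
  \<comment> \<open>The missing absolute values are appended with positive sign.\<close>
  obtain r where r: "set r = ?A - abs ` set l" "distinct r"
    using finite_distinct_list[of "?A - abs ` set l"] by auto
  have abs_r: "map abs r = r"
    using r(1) by (intro map_idI) auto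
  then have "abs ` set r = set r"
    by (metis list.set_map)
  then have "l @ r \<in> signed_arrangements ?A"
    using l r abs_r by (auto simp: signed_arrangements_def image_Un)
  then obtain g where g: "g \<in> signed_perms n" "arrangement n x g = l @ r"
    using bij_betw_arrangement[OF assms] by (metis (no_types, lifting) bij_betw_imp_surj_on imageE)
  have len: "length l \<le> n"
    using arg_cong[OF g(2), of length] by simp
  moreover have "length l \<in> {1..n}"
    using len l(1) by (cases l) auto
  ultimately show "sum_list l \<noteq> 0"
    using assms g sum_list_take_arrangement[of "length l" n x g]
    by (auto simp: regular_point_def)
qed

section \<open>The cardinality of \<open>N_set\<close>\<close>

lemma in_N_set_iff:
  assumes "regular_point n x" "g \<in> signed_perms n"
  shows "g \<in> N_set n x \<longleftrightarrow> positive_walk (arrangement n x g)"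
proof -
  have "act n g x \<in> Rn n" by (simp add: Rn_def act_def)
  then have "g \<in> N_set n x \<longleftrightarrow> (\<forall>k\<in>{1..n}. 0 \<le> partial_sum k (act n g x))"
    using assms(2) by (simp add: N_set_def C_SA_def)
  \<comment> \<open>Regularity excludes zero partial sums, so weak and strict inequalities
    agree.\<close>
  also have "\<dots> \<longleftrightarrow> (\<forall>k\<in>{1..n}. 0 < sum_list (take k (arrangement n x g)))"
    using assms by (auto simp: sum_list_take_arrangement regular_point_def less_le)
  also have "\<dots> \<longleftrightarrow> positive_walk (arrangement n x g)"
  proof
    assume *: "\<forall>k\<in>{1..n}. 0 < sum_list (take k (arrangement n x g))"
    show "positive_walk (arrangement n x g)"
      unfolding positive_walk_def
    proof (intro allI impI)
      fix p q assume pq: "arrangement n x g = p @ q" "p \<noteq> []"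
      have "length p \<in> {1..n}"
        using pq(2) arg_cong[OF pq(1), of length] by (cases p) auto
      then show "0 < sum_list p" using * pq(1) by force
    qed
  next
    assume *: "positive_walk (arrangement n x g)"
    show "\<forall>k\<in>{1..n}. 0 < sum_list (take k (arrangement n x g))"
    proof
      fix k assume "k \<in> {1..n}"
      then have "take k (arrangement n x g) \<noteq> []"
        by (metis atLeastAtMost_iff length_arrangement list.size(3) not_one_le_zero
            order.trans take_eq_Nil)
      then show "0 < sum_list (take k (arrangement n x g))"
        using * unfolding positive_walk_def by (metis append_take_drop_id)
    qed
  qed
  finally show ?thesis .
qed

lemma card_N_set:
  assumes "regular_point n x"
  shows "card (N_set n x) = double_fact (2 * n - 1)"
proof -
  let ?A = "(\<lambda>i. \<bar>x i\<bar>) ` {1..n}"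
  note bij = bij_betw_arrangement[OF assms]
  have sub: "N_set n x \<subseteq> signed_perms n" by (auto simp: N_set_def)
  \<comment> \<open>The bijection onto all signed arrangements restricts to one from
    \<open>N_set n x\<close> onto the positive ones.\<close>
  have "arrangement n x ` N_set n x = positive_arrangements ?A"
    using in_N_set_iff[OF assms] sub bij_betw_imp_surj_on[OF bij]
    by (fastforce simp: positive_arrangements_def)
  then have "card (N_set n x) = card (positive_arrangements ?A)"
    using bij_betw_same_card[OF bij_betw_subset[OF bij sub]] by simp
  also have "\<dots> = double_fact (2 * card ?A - 1)"
    using regular_point_nonzero[OF assms] regular_point_generic[OF assms]
    by (intro card_positive_arrangements) auto
  also have "card ?A = n"
    using card_image[OF regular_point_inj_on_abs[OF assms]] by simp
  finally show ?thesis .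
qed

theorem theorem3:
  fixes n :: nat
  assumes "n \<ge> 1"
  shows "(\<forall>x. regular_point n x \<longrightarrow>
            card (N_set n x) = double_fact (2 * n - 1) \<and>
            real (double_fact (2 * n - 1)) = fact (2 * n) / (2 ^ n * fact n)) \<and>
         (\<forall>x y. regular_point n x \<longrightarrow> regular_point n y \<longrightarrow>
            card (N_set n x) = card (N_set n y))"
proof -
  have "real (double_fact (2 * n - 1)) * (2 ^ n * fact n) = fact (2 * n)"
    using arg_cong[OF double_fact_odd[of n], of real] by (simp add: of_nat_fact)
  then have "real (double_fact (2 * n - 1)) = fact (2 * n) / (2 ^ n * fact n)"
    by (simp add: eq_divide_eq)
  then show ?thesis
    using card_N_set by simp
qed

end
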